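(* Let $q\ge2$, let $\mathcal F$ be a finite fix-free code over $\mathcal X=\{0,\ldots,q-1\}$, let $r$ be an integer upper bound on the lengths of the codewords of $\mathcal F$, and let $L$ be an integer with $r<L<2r$. With the matrices $A$, $C$ and the set $\mathcal W_L(\mathcal F)$ defined in the context, $$|\mathcal W_L(\mathcal F)|=q^L\bigl(1-K(\mathcal F)\bigr)-\mathbf e^{\mathsf T}AC\,\mathbf e .$$
   Context: A code is fix-free if no codeword is a proper prefix or proper suffix of another. $K(\mathcal F)=\sum_{f\in\mathcal F}q^{-|f|}$. $\mathcal W_L(\mathcal F)$ is the set of length-$L$ words $w\notin\mathcal F$ such that $\mathcal F\cup\{w\}$ is fix-free. The length-$r$ prefix and suffix shadows are $\mathcal P_r(\mathcal F)=\bigcup_{f\in\mathcal F}f\mathcal X^{r-|f|}$ and $\mathcal S_r(\mathcal F)=\bigcup_{f\in\mathcal F}\mathcal X^{r-|f|}f$. Put $h=2r-L$, $d=q^h$. Matrices are $d\times d$ with rows and columns indexed by $a,b\in\mathcal X^h$ (in base-$q$ numerical order); $\mathrm{pref}_h,\mathrm{suff}_h$ denote length-$h$ prefix and suffix: $M_{a,b}=|\{x\in\mathcal X^r:\mathrm{pref}_h(x)=a,\mathrm{suff}_h(x)=b\}|$, $A_{a,b}=|\{x\in\mathcal P_r(\mathcal F):\mathrm{pref}_h(x)=a,\mathrm{suff}_h(x)=b\}|$, $B_{a,b}=|\{x\in\mathcal S_r(\mathcal F):\mathrm{pref}_h(x)=a,\mathrm{suff}_h(x)=b\}|$, and $C=M-B$.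 $\mathbf e\in\mathbb R^d$ is the all-ones vector. *)

theory Defs
  imports Complex_Main "HOL-Library.Sublist" "Jordan_Normal_Form.Matrix"
begin

text \<open>Words over the alphabet $\{0,\ldots,q-1\}$ are lists of natural numbers less than $q$.\<close>

definition words :: "nat \<Rightarrow> nat \<Rightarrow> nat list set" where
  "words q n = {w. set w \<subseteq> {..<q} \<and> length w = n}"

text \<open>The empty word is not excluded; the only fix-free code containing it is the singleton.\<close>

definition fix_free :: "nat list set \<Rightarrow> bool" where
  "fix_free F \<longleftrightarrow> (\<forall>f\<in>F. \<forall>g\<in>F. \<not> strict_prefix f g \<and> \<not> strict_suffix f g)"

definition kraft_sum :: "nat \<Rightarrow> nat list set \<Rightarrow> real" where
  "kraft_sum q F = (\<Sum>f\<in>F. 1 / real q ^ length f)"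

definition admissible_words :: "nat \<Rightarrow> nat \<Rightarrow> nat list set \<Rightarrow> nat list set" where
  "admissible_words q L F = {w \<in> words q L. w \<notin> F \<and> fix_free (insert w F)}"

text \<open>The shadows are meant for \<open>r\<close> at least the length of every codeword, so that the
  subtraction below does not truncate.\<close>

definition prefix_shadow :: "nat \<Rightarrow> nat \<Rightarrow> nat list set \<Rightarrow> nat list set" where
  "prefix_shadow q r F = (\<Union>f\<in>F. (\<lambda>u. f @ u) ` words q (r - length f))"

definition suffix_shadow :: "nat \<Rightarrow> nat \<Rightarrow> nat list set \<Rightarrow> nat list set" where
  "suffix_shadow q r F = (\<Union>f\<in>F. (\<lambda>u. u @ f) ` words q (r - length f))"

text \<open>The \<open>i\<close>-th word of length \<open>h\<close> in base-\<open>q\<close> numerical order (from \<open>i = 0\<close>), i.e. the \<open>h\<close>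
  base-\<open>q\<close> digits of \<open>i\<close>, most significant digit first.\<close>

definition nth_word :: "nat \<Rightarrow> nat \<Rightarrow> nat \<Rightarrow> nat list" where
  "nth_word q h i = map (\<lambda>k. i div q ^ (h - 1 - k) mod q) [0..<h]"

definition suff :: "nat \<Rightarrow> 'a list \<Rightarrow> 'a list" where
  "suff h x = drop (length x - h) x"

text \<open>Counting matrix of a set \<open>S\<close> of words: the entry at \<open>(a, b)\<close> is the number of words in \<open>S\<close>
  with length-\<open>h\<close> prefix \<open>a\<close> and length-\<open>h\<close> suffix \<open>b\<close>.\<close>

definition border_mat :: "nat \<Rightarrow> nat \<Rightarrow> nat list set \<Rightarrow> real mat" where
  "border_mat q h S = mat (q ^ h) (q ^ h)
     (\<lambda>(i, j). real (card {x \<in> S. take h x = nth_word q h i \<and> suff h x = nth_word q h j}))"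

definition mat_M :: "nat \<Rightarrow> nat \<Rightarrow> nat \<Rightarrow> real mat" where
  "mat_M q h r = border_mat q h (words q r)"

definition mat_A :: "nat \<Rightarrow> nat \<Rightarrow> nat \<Rightarrow> nat list set \<Rightarrow> real mat" where
  "mat_A q h r F = border_mat q h (prefix_shadow q r F)"

definition mat_B :: "nat \<Rightarrow> nat \<Rightarrow> nat \<Rightarrow> nat list set \<Rightarrow> real mat" where
  "mat_B q h r F = border_mat q h (suffix_shadow q r F)"

definition mat_C :: "nat \<Rightarrow> nat \<Rightarrow> nat \<Rightarrow> nat list set \<Rightarrow> real mat" where
  "mat_C q h r F = mat_M q h r - mat_B q h r F"

definition all_ones :: "nat \<Rightarrow> real vec" where
  "all_ones d = vec d (\<lambda>_. 1)"

end

theory Submission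
  imports Defs
begin

text \<open>A word \<open>w\<close> of length \<open>L > r\<close> is admissible iff no codeword is a prefix or a suffix of it.
  Fix-freeness makes the codeword suffix of \<open>w\<close> unique, so exactly \<open>q\<^sup>L K(F)\<close> words have one.
  The words with a codeword prefix but no codeword suffix are glued from their length-\<open>r\<close> prefix,
  in the prefix shadow, and their length-\<open>r\<close> suffix, outside the suffix shadow, which overlap in a
  block of length \<open>h\<close>; summing over the overlap block is the inner summation of the product \<open>A C\<close>.\<close>

section \<open>Words of fixed length\<close>

lemma finite_words: "finite (words q n)"
  unfolding words_def using finite_lists_length_eq[of "{..<q}" n] by simp

lemma card_words: "card (words q n) = q ^ n"
  unfolding words_def using card_lists_length_eq[of "{..<q}" n] by simp

lemma length_words: "w \<in> words q n \<Longrightarrow> length w = n"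
  by (simp add: words_def)

lemma take_words: "w \<in> words q n \<Longrightarrow> m \<le> n \<Longrightarrow> take m w \<in> words q m"
  using set_take_subset[of m w] by (auto simp: words_def)

lemma drop_words: "w \<in> words q n \<Longrightarrow> drop m w \<in> words q (n - m)"
  using set_drop_subset[of m w] by (auto simp: words_def)

lemma append_words: "u \<in> words q m \<Longrightarrow> v \<in> words q n \<Longrightarrow> u @ v \<in> words q (m + n)"
  by (auto simp: words_def)

lemma suff_words:
  assumes "w \<in> words q n" "m \<le> n"
  shows "suff m w \<in> words q m"
  using drop_words[OF assms(1), of "n - m"] assms by (simp add: suff_def length_words)

section \<open>Base-\<open>q\<close> numbering of the words\<close>

lemma nth_word_Suc: "nth_word q (Suc h) i = nth_word q h (i div q) @ [i mod q]"
proof -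
  have "i div q ^ (h - k) mod q = i div q div q ^ (h - 1 - k) mod q" if "k < h" for k
  proof -
    \<comment> \<open>Splitting one factor \<open>q\<close> off \<open>q ^ (h - k)\<close> turns the
      single division into a division by \<open>q\<close> followed by one by
      \<open>q ^ (h - 1 - k)\<close>.\<close>
    have "h - k = Suc (h - 1 - k)" using that by simp
    then show ?thesis by (simp add: div_mult2_eq)
  qed
  then show ?thesis by (simp add: nth_word_def)
qed

lemma nth_word_in_words: "0 < q \<Longrightarrow> nth_word q h i \<in> words q h"
  by (auto simp: nth_word_def words_def)

lemma inj_on_nth_word: "inj_on (nth_word q h) {..<q ^ h}"
proof (induction h)
  case 0
  then show ?case by (simp add: inj_on_def)
next
  case (Suc h)
  show ?case
  proof (rule inj_onI)
    fix i j
    assume ij: "i \<in> {..<q ^ Suc h}" "j \<in> {..<q ^ Suc h}"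
      and eq: "nth_word q (Suc h) i = nth_word q (Suc h) j"
    have "i div q \<in> {..<q ^ h}" "j div q \<in> {..<q ^ h}"
      using ij by (auto simp: less_mult_imp_div_less mult.commute)
    moreover have "nth_word q h (i div q) = nth_word q h (j div q)" "i mod q = j mod q"
      using eq by (simp_all add: nth_word_Suc)
    ultimately have "i div q = j div q" using Suc.IH by (simp add: inj_on_eq_iff)
    then show "i = j" using \<open>i mod q = j mod q\<close> by (metis div_mult_mod_eq)
  qed
qed

text \<open>Surjectivity comes from counting: the image of an injective map on \<open>q ^ h\<close>
  indices fills a set of the same finite size.\<close>

lemma bij_betw_nth_word:
  assumes "0 < q"
  shows "bij_betw (nth_word q h) {..<q ^ h} (words q h)"
  unfolding bij_betw_def
proof
  show "nth_word q h ` {..<q ^ h} = words q h"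
    using nth_word_in_words[OF assms]
    by (intro card_subset_eq) (auto simp: finite_words card_words card_image inj_on_nth_word)
qed (rule inj_on_nth_word)

text \<open>Translates sums over matrix indices into counts of words. It serves for the row sums,
  for the column sums and for the overlap block.\<close>

lemma sum_card_nth_word_fibres:
  assumes "0 < q" "finite X" "\<And>x. x \<in> X \<Longrightarrow> f x \<in> words q h"
  shows "(\<Sum>i<q ^ h. card {x \<in> X. f x = nth_word q h i}) = card X"
proof -
  have "(\<Sum>i<q ^ h. card {x \<in> X. f x = nth_word q h i}) = (\<Sum>w\<in>words q h. card {x \<in> X. f x = w})"
    by (rule sum.reindex_bij_betw[OF bij_betw_nth_word[OF assms(1)]])
  also have "\<dots> = (\<Sum>w\<in>words q h. \<Sum>x\<in>{x \<in> X. f x = w}. 1)"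
    by simp
  also have "\<dots> = (\<Sum>x\<in>X. 1)"
    using assms(2,3) by (intro sum.group finite_words) auto
  finally show ?thesis by simp
qed

section \<open>Shadows and the admissible words\<close>

lemma prefix_shadow_eq:
  assumes "F \<subseteq> lists {..<q}" "\<forall>f\<in>F. length f \<le> n"
  shows "prefix_shadow q n F = {w \<in> words q n. \<exists>f\<in>F. prefix f w}"
proof (intro equalityI subsetI)
  fix w assume "w \<in> prefix_shadow q n F"
  then obtain f u where "f \<in> F" "u \<in> words q (n - length f)" "w = f @ u"
    by (auto simp: prefix_shadow_def)
  moreover have "f \<in> words q (length f)" using \<open>f \<in> F\<close> assms(1) by (auto simp: words_def)
  ultimately show "w \<in> {w \<in> words q n. \<exists>f\<in>F. prefix f w}"
    using append_words[of f q "length f" u "n - length f"] assms(2) by (auto intro: prefixI)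
next
  fix w assume "w \<in> {w \<in> words q n. \<exists>f\<in>F. prefix f w}"
  then show "w \<in> prefix_shadow q n F"
    by (force simp: prefix_shadow_def prefix_def words_def)
qed

lemma suffix_shadow_eq:
  assumes "F \<subseteq> lists {..<q}" "\<forall>f\<in>F. length f \<le> n"
  shows "suffix_shadow q n F = {w \<in> words q n. \<exists>f\<in>F. suffix f w}"
proof (intro equalityI subsetI)
  fix w assume "w \<in> suffix_shadow q n F"
  then obtain f u where "f \<in> F" "u \<in> words q (n - length f)" "w = u @ f"
    by (auto simp: suffix_shadow_def)
  moreover have "f \<in> words q (length f)" using \<open>f \<in> F\<close> assms(1) by (auto simp: words_def)
  ultimately show "w \<in> {w \<in> words q n. \<exists>f\<in>F. suffix f w}"
    using append_words[of u q "n - length f" f "length f"] assms(2) by (auto intro: suffixI)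
next
  fix w assume "w \<in> {w \<in> words q n. \<exists>f\<in>F. suffix f w}"
  then show "w \<in> suffix_shadow q n F"
    by (force simp: suffix_shadow_def suffix_def words_def)
qed

text \<open>The union is disjoint, because two codewords that are suffixes of one word are
  comparable and hence equal by fix-freeness. Each \<open>f\<close> contributes
  \<open>q ^ (n - length f)\<close> words.\<close>

lemma card_suffix_shadow:
  assumes "0 < q" "finite F" "fix_free F" "\<forall>f\<in>F. length f \<le> n"
  shows "real (card (suffix_shadow q n F)) = real q ^ n * kraft_sum q F"
proof -
  have "card (suffix_shadow q n F) = (\<Sum>f\<in>F. card ((\<lambda>u. u @ f) ` words q (n - length f)))"
    unfolding suffix_shadow_def
  proof (rule card_UN_disjoint[OF assms(2)])
    show "\<forall>f\<in>F. finite ((\<lambda>u. u @ f) ` words q (n - length f))"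
      by (simp add: finite_words)
    show "\<forall>f\<in>F. \<forall>g\<in>F. f \<noteq> g \<longrightarrow>
      (\<lambda>u. u @ f) ` words q (n - length f) \<inter> (\<lambda>u. u @ g) ` words q (n - length g) = {}"
    proof (intro ballI impI equals0I)
      fix f g w assume fg: "f \<in> F" "g \<in> F" "f \<noteq> g"
        and "w \<in> (\<lambda>u. u @ f) ` words q (n - length f) \<inter> (\<lambda>u. u @ g) ` words q (n - length g)"
      then have "suffix f w" "suffix g w" by (auto simp: suffix_def)
      then have "suffix f g \<or> suffix g f" by (rule suffix_same_cases)
      then show False using fg assms(3) by (auto simp: fix_free_def strict_suffix_def)
    qed
  qed
  also have "\<dots> = (\<Sum>f\<in>F. q ^ (n - length f))"
    by (simp add: card_image card_words inj_on_def)
  finally have "real (card (suffix_shadow q n F)) = (\<Sum>f\<in>F. real q ^ (n - length f))"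
    by simp
  also have "\<dots> = (\<Sum>f\<in>F. real q ^ n * (1 / real q ^ length f))"
    using assms(1,4) by (intro sum.cong) (auto simp: power_diff)
  finally show ?thesis by (simp add: kraft_sum_def sum_distrib_left)
qed

text \<open>Codewords strictly shorter than \<open>w\<close> cannot equal \<open>w\<close> or have
  it as a prefix or suffix. The only possible conflicts are therefore codewords at the two ends of
  \<open>w\<close>, and for these the strict and non-strict orders agree.\<close>

lemma admissible_words_eq:
  assumes "F \<subseteq> lists {..<q}" "fix_free F" "\<forall>f\<in>F. length f < L"
  shows "admissible_words q L F = words q L - (prefix_shadow q L F \<union> suffix_shadow q L F)"
proof -
  have "w \<notin> F \<and> fix_free (insert w F) \<longleftrightarrow> \<not> (\<exists>f\<in>F. prefix f w) \<and> \<not> (\<exists>f\<in>F. suffix f w)"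
    if "w \<in> words q L" for w
  proof -
    have shorter: "length f < length w" if "f \<in> F" for f
      using that \<open>w \<in> words q L\<close> assms(3) by (simp add: length_words)
    have "w \<notin> F" using shorter by blast
    moreover have "\<not> prefix w f" "\<not> suffix w f" if "f \<in> F" for f
      using shorter[OF that] prefix_length_le suffix_length_le by fastforce+
    ultimately show ?thesis
      using assms(2) unfolding fix_free_def strict_prefix_def strict_suffix_def by blast
  qed
  moreover have "\<forall>f\<in>F. length f \<le> L" using assms(3) by auto
  ultimately show ?thesis
    unfolding admissible_words_def
      prefix_shadow_eq[OF assms(1) \<open>\<forall>f\<in>F. length f \<le> L\<close>]
      suffix_shadow_eq[OF assms(1) \<open>\<forall>f\<in>F. length f \<le> L\<close>]
    by blast
qed

section \<open>Decomposition of a word into two overlapping windows\<close>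

lemma prefix_take_iff: "length f \<le> n \<Longrightarrow> prefix f (take n w) \<longleftrightarrow> prefix f w"
  by (metis append_take_drop_id prefixI prefix_length_prefix prefix_order.trans
      take_is_prefix take_all_iff nle_le length_take min.absorb2)

lemma suffix_drop_iff: "length f + n \<le> length w \<Longrightarrow> suffix f (drop n w) \<longleftrightarrow> suffix f w"
  by (metis add_le_imp_le_diff length_drop suffix_drop suffix_length_suffix suffix_order.trans)

text \<open>A codeword has length at most \<open>r\<close>, so the first and last \<open>r\<close>
  letters of \<open>w\<close> already decide whether one occurs at either end.\<close>

lemma shadow_diff_eq:
  assumes "F \<subseteq> lists {..<q}" "\<forall>f\<in>F. length f \<le> r" "r \<le> L"
  shows "prefix_shadow q L F - suffix_shadow q L F =
    {w \<in> words q L. take r w \<in> prefix_shadow q r F \<and>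
                    drop (L - r) w \<in> words q r - suffix_shadow q r F}"
proof -
  have "\<forall>f\<in>F. length f \<le> L" using assms(2,3) by auto
  note eqs = prefix_shadow_eq[OF assms(1) this] suffix_shadow_eq[OF assms(1) this]
    prefix_shadow_eq[OF assms(1,2)] suffix_shadow_eq[OF assms(1,2)]
  have "(\<exists>f\<in>F. prefix f (take r w)) \<longleftrightarrow> (\<exists>f\<in>F. prefix f w)"
    "(\<exists>f\<in>F. suffix f (drop (L - r) w)) \<longleftrightarrow> (\<exists>f\<in>F. suffix f w)"
    "take r w \<in> words q r" "drop (L - r) w \<in> words q r" if "w \<in> words q L" for w
  proof -
    have "suffix f (drop (L - r) w) \<longleftrightarrow> suffix f w" if "f \<in> F" for f
      using that assms(2,3) \<open>w \<in> words q L\<close>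
      by (intro suffix_drop_iff) (force simp: length_words)
    then show "(\<exists>f\<in>F. suffix f (drop (L - r) w)) \<longleftrightarrow> (\<exists>f\<in>F. suffix f w)" by blast
  qed (use that assms(2,3) take_words[OF that assms(3)] drop_words[OF that, of "L - r"]
      in \<open>auto simp: prefix_take_iff\<close>)
  then show ?thesis unfolding eqs by blast
qed

text \<open>The windows occupy positions from 0 to before \<open>r\<close> and from
  \<open>L - r\<close> to before \<open>L\<close>. They cover the whole word as
  \<open>L \<le> 2 * r\<close>, and share \<open>h\<close> letters, on which agreement is the only
  constraint.\<close>

lemma bij_betw_overlap:
  assumes "r \<le> L" "L \<le> 2 * r" "h = 2 * r - L" "X \<subseteq> words q r" "Y \<subseteq> words q r"
  shows "bij_betw (\<lambda>w. (take r w, drop (L - r) w))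
    {w \<in> words q L. take r w \<in> X \<and> drop (L - r) w \<in> Y}
    {(x, y). x \<in> X \<and> y \<in> Y \<and> suff h x = take h y}"
proof (rule bij_betw_byWitness[where f' = "\<lambda>(x, y). x @ drop h y"])
  show "\<forall>w\<in>{w \<in> words q L. take r w \<in> X \<and> drop (L - r) w \<in> Y}.
    (case (take r w, drop (L - r) w) of (x, y) \<Rightarrow> x @ drop h y) = w"
    \<comment> \<open>Since \<open>h + (L - r) = r\<close>, removing the overlap from the second
      window leaves \<open>drop r w\<close>.\<close>
    using assms(1-3) by simp
  have glue: "take r (x @ drop h y) = x" "drop (L - r) (x @ drop h y) = y"
    "x @ drop h y \<in> words q L"
    if "x \<in> X" "y \<in> Y" "suff h x = take h y" for x y
  proof -
    have xy: "x \<in> words q r" "y \<in> words q r" using that assms(4,5) by auto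
    then have len: "length x = r" "length y = r" by (simp_all add: length_words)
    show "take r (x @ drop h y) = x" using len by simp
    \<comment> \<open>Here \<open>L - r = r - h\<close>, so what remains of \<open>x\<close> is its
      suffix of length \<open>h\<close>.\<close>
    have "drop (L - r) x = take h y"
      using that(3) len assms(1-3) by (simp add: suff_def)
    then show "drop (L - r) (x @ drop h y) = y"
      using len assms(1-3) by simp
    show "x @ drop h y \<in> words q L"
      using append_words[OF xy(1) drop_words[OF xy(2), of h]] assms(1-3) by simp
  qed
  then show "\<forall>p\<in>{(x, y). x \<in> X \<and> y \<in> Y \<and> suff h x = take h y}.
    (take r (case p of (x, y) \<Rightarrow> x @ drop h y), drop (L - r) (case p of (x, y) \<Rightarrow> x @ drop h y)) = p"
    by auto
  show "(\<lambda>w. (take r w, drop (L - r) w)) ` {w \<in> words q L. take r w \<in> X \<and> drop (L - r) w \<in> Y}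
    \<subseteq> {(x, y). x \<in> X \<and> y \<in> Y \<and> suff h x = take h y}"
  proof (clarsimp)
    fix w assume "w \<in> words q L"
    then show "suff h (take r w) = take h (drop (L - r) w)"
      using assms(1-3) by (simp add: suff_def drop_take length_words mult_2)
  qed
  show "(\<lambda>(x, y). x @ drop h y) ` {(x, y). x \<in> X \<and> y \<in> Y \<and> suff h x = take h y}
    \<subseteq> {w \<in> words q L. take r w \<in> X \<and> drop (L - r) w \<in> Y}"
    using glue by auto
qed

lemma card_overlap:
  assumes "0 < q" "r \<le> L" "L \<le> 2 * r" "h = 2 * r - L" "X \<subseteq> words q r" "Y \<subseteq> words q r"
  shows "card {w \<in> words q L. take r w \<in> X \<and> drop (L - r) w \<in> Y} =
    (\<Sum>k<q ^ h. card {x \<in> X. suff h x = nth_word q h k} * card {y \<in> Y. take h y = nth_word q h k})"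
proof -
  define Z where "Z = {(x, y). x \<in> X \<and> y \<in> Y \<and> suff h x = take h y}"
  have "h \<le> r" using assms(2-4) by simp
  have finite: "finite Z"
    by (rule finite_subset[of _ "words q r \<times> words q r"])
      (use assms(5,6) in \<open>auto simp: Z_def finite_words\<close>)
  \<comment> \<open>Once the overlap block \<open>b\<close> is fixed, the matching condition
    separates into one condition on \<open>x\<close> and one on \<open>y\<close>, so each fibre is a
    Cartesian product.\<close>
  have fibre: "{z \<in> Z. take h (snd z) = b} =
      {x \<in> X. suff h x = b} \<times> {y \<in> Y. take h y = b}" for b
    by (auto simp: Z_def)
  have "card {w \<in> words q L. take r w \<in> X \<and> drop (L - r) w \<in> Y} = card Z"
    unfolding Z_def using bij_betw_overlap[OF assms(2-6)] by (rule bij_betw_same_card)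
  also have "\<dots> = (\<Sum>k<q ^ h. card {z \<in> Z. take h (snd z) = nth_word q h k})"
    using take_words[OF _ \<open>h \<le> r\<close>] assms(6)
    by (intro sum_card_nth_word_fibres[symmetric] assms(1) finite) (auto simp: Z_def)
  finally show ?thesis by (simp add: fibre card_cartesian_product)
qed

section \<open>Row and column sums of counting matrices\<close>

lemma border_mat_carrier: "border_mat q h S \<in> carrier_mat (q ^ h) (q ^ h)"
  by (simp add: border_mat_def)

text \<open>Summing over all prefixes removes the prefix condition, since \<open>h \<le> r\<close>
  gives every word of \<open>S\<close> exactly one prefix of length \<open>h\<close>. These
  one-sided counts are the first factors in \<open>card_overlap\<close>; row sums give the
  second.\<close>

lemma border_mat_col_sum:
  assumes "0 < q" "h \<le> r" "S \<subseteq> words q r" "k < q ^ h"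
  shows "(\<Sum>i<q ^ h. border_mat q h S $$ (i, k)) = real (card {x \<in> S. suff h x = nth_word q h k})"
proof -
  have "{x \<in> S. take h x = nth_word q h i \<and> suff h x = nth_word q h k} =
      {x \<in> {x \<in> S. suff h x = nth_word q h k}. take h x = nth_word q h i}" for i
    by auto
  moreover have "(\<Sum>i<q ^ h. card {x \<in> {x \<in> S. suff h x = nth_word q h k}. take h x = nth_word q h i})
      = card {x \<in> S. suff h x = nth_word q h k}"
    using assms(3) finite_subset[OF assms(3) finite_words]
    by (intro sum_card_nth_word_fibres assms(1)) (auto intro: take_words[OF _ assms(2)])
  ultimately show ?thesis
    using assms(4) by (simp add: border_mat_def flip: of_nat_sum)
qed

lemma border_mat_row_sum:
  assumes "0 < q" "h \<le> r" "S \<subseteq> words q r" "k < q ^ h"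
  shows "(\<Sum>j<q ^ h. border_mat q h S $$ (k, j)) = real (card {x \<in> S. take h x = nth_word q h k})"
proof -
  have "{x \<in> S. take h x = nth_word q h k \<and> suff h x = nth_word q h j} =
      {x \<in> {x \<in> S. take h x = nth_word q h k}. suff h x = nth_word q h j}" for j
    by auto
  moreover have "(\<Sum>j<q ^ h. card {x \<in> {x \<in> S. take h x = nth_word q h k}. suff h x = nth_word q h j})
      = card {x \<in> S. take h x = nth_word q h k}"
    using assms(3) finite_subset[OF assms(3) finite_words]
    by (intro sum_card_nth_word_fibres assms(1)) (auto intro: suff_words[OF _ assms(2)])
  ultimately show ?thesis
    using assms(4) by (simp add: border_mat_def flip: of_nat_sum)
qed

text \<open>Identifies \<open>C = M - B\<close> as the counting matrix of the words outside the
  suffix shadow.\<close>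

lemma border_mat_Diff:
  assumes "finite S" "T \<subseteq> S"
  shows "border_mat q h (S - T) = border_mat q h S - border_mat q h T"
proof (rule eq_matI)
  fix i j assume "i < dim_row (border_mat q h S - border_mat q h T)"
    "j < dim_col (border_mat q h S - border_mat q h T)"
  then have ij: "i < q ^ h" "j < q ^ h" by (simp_all add: border_mat_def)
  define P where "P x \<longleftrightarrow> take h x = nth_word q h i \<and> suff h x = nth_word q h j" for x
  have "{x \<in> S - T. P x} = {x \<in> S. P x} - {x \<in> T. P x}" by auto
  moreover have "{x \<in> T. P x} \<subseteq> {x \<in> S. P x}" "finite {x \<in> S. P x}" using assms by auto
  ultimately have "real (card {x \<in> S - T. P x}) = real (card {x \<in> S. P x}) - real (card {x \<in> T. P x})"
    by (simp add: card_Diff_subset card_mono finite_subset of_nat_diff)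
  then show "border_mat q h (S - T) $$ (i, j) = (border_mat q h S - border_mat q h T) $$ (i, j)"
    using ij by (simp add: border_mat_def P_def)
qed (simp_all add: border_mat_def)

lemma all_ones_quadratic:
  assumes "A \<in> carrier_mat d d" "C \<in> carrier_mat d d"
  shows "all_ones d \<bullet> ((A * C) *\<^sub>v all_ones d) =
    (\<Sum>k<d. (\<Sum>i<d. A $$ (i, k)) * (\<Sum>j<d. C $$ (k, j)))"
proof -
  have "all_ones d \<bullet> ((A * C) *\<^sub>v all_ones d) = (\<Sum>i<d. \<Sum>j<d. \<Sum>k<d. A $$ (i, k) * C $$ (k, j))"
  proof -
    have "((A * C) *\<^sub>v all_ones d) $ i = (\<Sum>j<d. \<Sum>k<d. A $$ (i, k) * C $$ (k, j))" if "i < d" for i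
      using assms that by (simp add: all_ones_def scalar_prod_def atLeast0LessThan
          times_mat_def mult_mat_vec_def)
    then show ?thesis
      using assms by (simp add: all_ones_def scalar_prod_def atLeast0LessThan)
  qed
  \<comment> \<open>Two interchanges bring the contracted index \<open>k\<close> outermost; for
    fixed \<open>k\<close> the sums over \<open>i\<close> and \<open>j\<close> then factor.\<close>
  also have "\<dots> = (\<Sum>i<d. \<Sum>k<d. \<Sum>j<d. A $$ (i, k) * C $$ (k, j))"
    by (intro sum.cong refl sum.swap)
  also have "\<dots> = (\<Sum>k<d. \<Sum>i<d. \<Sum>j<d. A $$ (i, k) * C $$ (k, j))"
    by (rule sum.swap)
  finally show ?thesis by (simp add: sum_product)
qed

section \<open>Counting the admissible words\<close>

theorem theorem5:
  fixes q r L h :: nat and F :: "nat list set"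
  assumes "q \<ge> 2"
    and "finite F"
    and "F \<subseteq> lists {..<q}"
    and "fix_free F"
    and "\<forall>f\<in>F. length f \<le> r"
    and "r < L" and "L < 2 * r"
    and "h = 2 * r - L"
  shows "real (card (admissible_words q L F)) =
    real q ^ L * (1 - kraft_sum q F) -
    all_ones (q ^ h) \<bullet> ((mat_A q h r F * mat_C q h r F) *\<^sub>v all_ones (q ^ h))"
proof -
  define P where "P = prefix_shadow q L F"
  define S where "S = suffix_shadow q L F"
  define X where "X = prefix_shadow q r F"
  define Y where "Y = words q r - suffix_shadow q r F"
  have "0 < q" "h \<le> r" "r \<le> L" "L \<le> 2 * r" using assms by auto
  have short: "\<forall>f\<in>F. length f < L" "\<forall>f\<in>F. length f \<le> L" using assms(5,6) by auto
  have PS: "P \<subseteq> words q L" "S \<subseteq> words q L"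
    unfolding P_def S_def using assms(3) short(2) by (auto simp: prefix_shadow_eq suffix_shadow_eq)
  have XY: "X \<subseteq> words q r" "Y \<subseteq> words q r" "suffix_shadow q r F \<subseteq> words q r"
    unfolding X_def Y_def using assms(3,5) by (auto simp: prefix_shadow_eq suffix_shadow_eq)
  note fin = finite_subset[OF PS(1) finite_words] finite_subset[OF PS(2) finite_words]

  \<comment> \<open>The forbidden words are split asymmetrically: \<open>S\<close> yields the Kraft
    term and \<open>P - S\<close> the matrix term.\<close>
  have "admissible_words q L F = words q L - (S \<union> (P - S))"
    unfolding P_def S_def using admissible_words_eq[OF assms(3,4) short(1)] by auto
  moreover have "card (S \<union> (P - S)) = card S + card (P - S)"
    using fin by (intro card_Un_disjoint) auto
  \<comment> \<open>This bound makes the subtraction of natural numbers exact when it is carried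
    over to the reals.\<close>
  moreover have "card (S \<union> (P - S)) \<le> card (words q L)"
    using PS by (intro card_mono finite_words) auto
  ultimately have "real (card (admissible_words q L F)) =
      real q ^ L - real (card S) - real (card (P - S))"
    using PS fin by (simp add: card_Diff_subset card_words of_nat_diff)
  moreover have "real (card S) = real q ^ L * kraft_sum q F"
    unfolding S_def by (rule card_suffix_shadow[OF \<open>0 < q\<close> assms(2,4) short(2)])
  moreover have "real (card (P - S)) =
    all_ones (q ^ h) \<bullet> ((mat_A q h r F * mat_C q h r F) *\<^sub>v all_ones (q ^ h))"
  proof -
    have A: "mat_A q h r F = border_mat q h X"
      by (simp add: mat_A_def X_def)
    have C: "mat_C q h r F = border_mat q h Y"
      unfolding mat_C_def mat_M_def mat_B_def Y_def
      using XY(3) by (simp add: border_mat_Diff finite_words)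
    have "card (P - S) = card {w \<in> words q L. take r w \<in> X \<and> drop (L - r) w \<in> Y}"
      unfolding P_def S_def X_def Y_def shadow_diff_eq[OF assms(3,5) \<open>r \<le> L\<close>] ..
    \<comment> \<open>Both sides become the same sum over the overlap block \<open>k\<close>: column
      \<open>k\<close> of \<open>A\<close> counts the words of \<open>X\<close> ending in that
      block, and row \<open>k\<close> of \<open>C\<close> counts the words of \<open>Y\<close>
      starting with it.\<close>
    then show ?thesis
      by (simp add: A C all_ones_quadratic[OF border_mat_carrier border_mat_carrier]
          card_overlap[OF \<open>0 < q\<close> \<open>r \<le> L\<close> \<open>L \<le> 2 * r\<close> assms(8) XY(1,2)]
          border_mat_col_sum[OF \<open>0 < q\<close> \<open>h \<le> r\<close> XY(1)]
          border_mat_row_sum[OF \<open>0 < q\<close> \<open>h \<le> r\<close> XY(2)])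
  qed
  ultimately show ?thesis by (simp add: algebra_simps)
qed

end
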